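(* For every positive integer $n$, with $i=\sqrt{-1}$, $$\sum_{\substack{0\le k\le n\\ 4\mid k-2}}\binom nkB_{n-k}(x)(-1)^{\frac{k-2}4}2^{n+1-\frac k2}=ni\big((2x-1-i)^{n-1}-(2x-1+i)^{n-1}\big).$$
   Context: The Bernoulli numbers $B_n$ are defined by $B_0=1$ and $\sum_{k=0}^{n-1}\binom nkB_k=0$ for $n\ge 2$; the Bernoulli polynomials are $B_n(x)=\sum_{k=0}^n\binom nkB_kx^{n-k}$ for $n\ge 0$. *)

theory Defs
  imports Complex_Main
begin

text \<open>
  The recurrence \<open>(\<Sum>k<n. (n choose k) * B k) = 0\<close> for \<open>n \<ge> 2\<close>, solved for its last
  term \<open>B (n - 1)\<close>, whose coefficient is \<open>n choose (n - 1) = n\<close>. In particular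
  \<open>B 1 = - 1 / 2\<close>.
\<close>

fun bernoulli :: "nat \<Rightarrow> real" where
  "bernoulli 0 = 1"
| "bernoulli (Suc n) =
     - (\<Sum>k\<le>n. of_nat (Suc (Suc n) choose k) * bernoulli k) / of_nat (Suc (Suc n))"

declare bernoulli.simps(2) [simp del]

lemma bernoulli_recurrence:
  assumes "n \<ge> 2"
  shows "(\<Sum>k<n. of_nat (n choose k) * bernoulli k) = 0"
proof -
  obtain m where n: "n = Suc (Suc m)"
    using assms by (metis Suc_le_D numeral_2_eq_2 Suc_le_mono)
  have "(\<Sum>k<n. of_nat (n choose k) * bernoulli k) =
      (\<Sum>k\<le>m. of_nat (n choose k) * bernoulli k) + of_nat (n choose Suc m) * bernoulli (Suc m)"
    by (simp add: n lessThan_Suc_atMost del: binomial_Suc_Suc)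
  also have "n choose Suc m = n"
    using binomial_symmetric[of "Suc m" n] by (simp add: n del: binomial_Suc_Suc)
  finally show ?thesis
    by (simp add: n bernoulli.simps(2) del: binomial_Suc_Suc of_nat_Suc)
qed

definition bernpoly :: "nat \<Rightarrow> complex \<Rightarrow> complex" where
  "bernpoly n x = (\<Sum>k\<le>n. of_nat (n choose k) * of_real (bernoulli k) * x ^ (n - k))"

end

theory Submission
  imports Defs
begin

text \<open>
  The four numbers \<open>y = (\<plusminus>1 \<plusminus> \<i>) / 2\<close> satisfy \<open>y ^ 4 = - 1 / 4\<close>, so their \<open>k\<close>-th powers, summed
  with signs that alternate around the circle, vanish unless \<open>k mod 4 = 2\<close>. Hence by the addition
  formula the left-hand side is, up to a constant, the alternating sum of the values
  \<open>B\<^sub>n (x + y)\<close>. The four values form two pairs of points at distance 1, to which the difference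
  equation \<open>B\<^sub>n (z + 1) - B\<^sub>n z = n z\<^bsup>n - 1\<^esup>\<close> applies.
\<close>

text \<open>Expanding \<open>(x + y) ^ (n - k)\<close> gives a double sum over the triangle
  \<open>k + j \<le> n\<close>; summing over \<open>k\<close> first collects the Bernoulli
  polynomial in \<open>x\<close> that multiplies \<open>y ^ j\<close>.\<close>

lemma bernpoly_add:
  "bernpoly n (x + y) = (\<Sum>k\<le>n. of_nat (n choose k) * bernpoly (n - k) x * y ^ k)"
proof -
  define t where "t k j = of_nat ((n choose k) * ((n - k) choose j)) * of_real (bernoulli k)
    * x ^ (n - k - j) * y ^ j" for k j
  have "bernpoly n (x + y) = (\<Sum>k\<in>{..n}. \<Sum>j\<in>{j\<in>{..n}. k + j \<le> n}. t k j)"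
    unfolding bernpoly_def
  proof (rule sum.cong[OF refl])
    fix k assume k: "k \<in> {..n}"
    have "(x + y) ^ (n - k) = (\<Sum>j\<le>n - k. of_nat ((n - k) choose j) * y ^ j * x ^ (n - k - j))"
      by (subst add.commute) (rule binomial_ring)
    moreover have "{..n - k} = {j\<in>{..n}. k + j \<le> n}"
      using k by auto
    ultimately show "of_nat (n choose k) * of_real (bernoulli k) * (x + y) ^ (n - k)
        = (\<Sum>j\<in>{j\<in>{..n}. k + j \<le> n}. t k j)"
      by (simp add: t_def sum_distrib_left mult_ac)
  qed
  also have "\<dots> = (\<Sum>j\<in>{..n}. \<Sum>k\<in>{k\<in>{..n}. k + j \<le> n}. t k j)"
    by (rule sum.swap_restrict) auto
  also have "\<dots> = (\<Sum>j\<le>n. of_nat (n choose j) * bernpoly (n - j) x * y ^ j)"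
  proof (rule sum.cong[OF refl])
    fix j assume j: "j \<in> {..n}"
    \<comment> \<open>Both sides are the trinomial coefficient n! / (k! j! (n - k - j)!).\<close>
    have swap: "(n choose k) * ((n - k) choose j) = (n choose j) * ((n - j) choose k)"
      if "k + j \<le> n" for k
    proof -
      have "(n choose (k + j)) * ((k + j) choose k) = (n choose k) * ((n - k) choose j)"
        using choose_mult[of k "k + j" n] that by simp
      moreover have "(n choose (k + j)) * ((k + j) choose j) = (n choose j) * ((n - j) choose k)"
        using choose_mult[of j "k + j" n] that by simp
      moreover have "(k + j) choose k = (k + j) choose j"
        using binomial_symmetric[of k "k + j"] by simp
      ultimately show ?thesis by simp
    qed
    have "t k j = of_nat (n choose j)
        * (of_nat ((n - j) choose k) * of_real (bernoulli k) * x ^ (n - j - k)) * y ^ j"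
      if "k + j \<le> n" for k
      unfolding t_def swap[OF that] diff_commute[of n k j] by simp
    moreover have "{k\<in>{..n}. k + j \<le> n} = {..n - j}"
      using j by auto
    ultimately show "(\<Sum>k\<in>{k\<in>{..n}. k + j \<le> n}. t k j)
        = of_nat (n choose j) * bernpoly (n - j) x * y ^ j"
      using j by (simp add: bernpoly_def sum_distrib_left sum_distrib_right)
  qed
  finally show ?thesis .
qed

lemma bernpoly_0: "bernpoly n 0 = of_real (bernoulli n)"
proof -
  have "bernpoly n 0 = (\<Sum>k\<le>n. if k = n then of_real (bernoulli n) else 0)"
    unfolding bernpoly_def by (rule sum.cong) auto
  then show ?thesis by simp
qed

text \<open>At 1 all powers are 1, and the term \<open>k = n\<close> is the value at 0. What remains
  is the sum of the defining recurrence, which fails to vanish only for \<open>n = 1\<close>, where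
  it is \<open>bernoulli 0\<close>.\<close>

lemma bernpoly_1_minus_0: "bernpoly n 1 - bernpoly n 0 = (if n = 1 then 1 else 0)"
proof -
  have "bernpoly n 1 - bernpoly n 0 = of_real (\<Sum>k<n. of_nat (n choose k) * bernoulli k)"
    unfolding bernpoly_0 by (simp add: bernpoly_def flip: lessThan_Suc_atMost)
  also have "\<dots> = (if n = 1 then 1 else 0)"
  proof (cases "n \<ge> 2")
    case True
    then show ?thesis by (simp only: bernoulli_recurrence) auto
  next
    case False
    then have "n = 0 \<or> n = 1" by auto
    then show ?thesis by auto
  qed
  finally show ?thesis .
qed

lemma bernpoly_diff:
  assumes "n > 0"
  shows "bernpoly n (z + 1) - bernpoly n z = of_nat n * z ^ (n - 1)"
proof -
  \<comment> \<open>Here \<open>z\<close> is the increment in the addition formula, with base points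
    1 and 0, so only the coefficient with \<open>n - k = 1\<close> survives.\<close>
  have "bernpoly n (z + 1) - bernpoly n z = bernpoly n (1 + z) - bernpoly n (0 + z)"
    by (simp add: add.commute)
  also have "\<dots> = (\<Sum>k\<le>n. of_nat (n choose k) * (bernpoly (n - k) 1 - bernpoly (n - k) 0) * z ^ k)"
    unfolding bernpoly_add by (simp add: sum_subtractf algebra_simps)
  also have "\<dots> = (\<Sum>k\<le>n. if k = n - 1 then of_nat n * z ^ (n - 1) else 0)"
  proof (rule sum.cong[OF refl])
    fix k assume "k \<in> {..n}"
    then have "n - k = 1 \<longleftrightarrow> k = n - 1"
      using assms by auto
    moreover have "n choose (n - 1) = n"
      using binomial_symmetric[of 1 n] assms by simp
    ultimately show "of_nat (n choose k) * (bernpoly (n - k) 1 - bernpoly (n - k) 0) * z ^ k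
        = (if k = n - 1 then of_nat n * z ^ (n - 1) else 0)"
      unfolding bernpoly_1_minus_0 by auto
  qed
  also have "\<dots> = of_nat n * z ^ (n - 1)"
    by simp
  finally show ?thesis .
qed

lemma alternating_power_sum:
  fixes k :: nat
  shows "((1 + \<i>) / 2) ^ k - ((- 1 + \<i>) / 2) ^ k + ((- 1 - \<i>) / 2) ^ k - ((1 - \<i>) / 2) ^ k
    = (if k mod 4 = 2 then 4 * \<i> * (- 1) ^ ((k - 2) div 4) / 2 ^ (k div 2) else 0)"
proof -
  define m r where "m = k div 4" and "r = k mod 4"
  have k: "k = 4 * m + r"
    by (simp add: m_def r_def)
  have y4: "((1 + \<i>) / 2) ^ 4 = - 1 / 4" "((- 1 + \<i>) / 2) ^ 4 = - 1 / 4"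
    "((- 1 - \<i>) / 2) ^ 4 = - 1 / 4" "((1 - \<i>) / 2) ^ 4 = - 1 / 4"
    by (simp_all add: power4_eq_xxxx complex_eq_iff)
  \<comment> \<open>The common fourth power factors out, which leaves the four cases
    \<open>r < 4\<close>.\<close>
  have "((1 + \<i>) / 2) ^ k - ((- 1 + \<i>) / 2) ^ k + ((- 1 - \<i>) / 2) ^ k - ((1 - \<i>) / 2) ^ k
    = (- 1 / 4) ^ m * (((1 + \<i>) / 2) ^ r - ((- 1 + \<i>) / 2) ^ r + ((- 1 - \<i>) / 2) ^ r
        - ((1 - \<i>) / 2) ^ r)"
    unfolding k power_add power_mult y4 by (simp add: algebra_simps)
  also have "((1 + \<i>) / 2) ^ r - ((- 1 + \<i>) / 2) ^ r + ((- 1 - \<i>) / 2) ^ r - ((1 - \<i>) / 2) ^ r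
    = (if r = 2 then 2 * \<i> else 0)"
  proof -
    have "r = 0 \<or> r = 1 \<or> r = 2 \<or> r = 3"
      unfolding r_def by presburger
    then show ?thesis
      by (auto simp: power2_eq_square power3_eq_cube complex_eq_iff)
  qed
  also have "(- 1 / 4) ^ m * (if r = 2 then 2 * \<i> else 0)
    = (if k mod 4 = 2 then 4 * \<i> * (- 1) ^ ((k - 2) div 4) / 2 ^ (k div 2) else 0)"
  proof (cases "r = 2")
    case True
    \<comment> \<open>Hence \<open>2 ^ (k div 2)\<close> is \<open>2 * 4 ^ m\<close>; the extra 2
      turns \<open>2 * \<i>\<close> into \<open>4 * \<i>\<close>.\<close>
    then have "k div 2 = 2 * m + 1" "(k - 2) div 4 = m"
      by (simp_all add: k)
    then show ?thesis
      using True unfolding power_divide[of "- 1" 4 m] by (simp add: r_def power_mult)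
  qed (simp add: r_def)
  finally show ?thesis .
qed

theorem theorem2p3:
  fixes n :: nat and x :: complex
  assumes "n > 0"
  shows "(\<Sum>k | k \<le> n \<and> 4 dvd int k - 2.
            of_nat (n choose k) * bernpoly (n - k) x * (-1) ^ ((k - 2) div 4)
              * 2 ^ (n + 1 - k div 2))
         = of_nat n * \<i> * ((2 * x - 1 - \<i>) ^ (n - 1) - (2 * x - 1 + \<i>) ^ (n - 1))"
    (is "?L = ?R")
proof -
  let ?y0 = "(1 + \<i>) / 2" and ?y1 = "(- 1 + \<i>) / 2"
  let ?y2 = "(- 1 - \<i>) / 2" and ?y3 = "(1 - \<i>) / 2"
  let ?c = "\<lambda>k. of_nat (n choose k) * bernpoly (n - k) x"
  \<comment> \<open>The cast to integers matters: truncated subtraction would admit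
    \<open>k = 0\<close> and \<open>k = 1\<close>.\<close>
  have mod4: "4 dvd int k - 2 \<longleftrightarrow> k mod 4 = 2" for k :: nat
    by presburger
  let ?D = "bernpoly n (x + ?y0) - bernpoly n (x + ?y1) + bernpoly n (x + ?y2) - bernpoly n (x + ?y3)"
  let ?S = "\<lambda>k. ?y0 ^ k - ?y1 ^ k + ?y2 ^ k - ?y3 ^ k"
  have D: "?D = (\<Sum>k\<le>n. ?c k * ?S k)"
    unfolding bernpoly_add
    by (simp only: sum_subtractf[symmetric] sum.distrib[symmetric] right_diff_distrib distrib_left)
  \<comment> \<open>The factor \<open>2 ^ (n + 1)\<close> absorbs the denominators
    \<open>2 ^ (k div 2)\<close>.\<close>
  have L: "2 ^ (n + 1) * ?D = 4 * \<i> * ?L"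
    unfolding D sum_distrib_left
  proof (rule sum.mono_neutral_cong_right)
    fix k assume "k \<in> {k. k \<le> n \<and> 4 dvd int k - 2}"
    then have k: "k \<le> n" "k mod 4 = 2"
      by (auto simp: mod4)
    then have "(2::complex) ^ (n + 1 - k div 2) = 2 ^ (n + 1) / 2 ^ (k div 2)"
      by (intro power_diff) auto
    with k show "2 ^ (n + 1) * (?c k * ?S k)
      = 4 * \<i> * (?c k * (-1) ^ ((k - 2) div 4) * 2 ^ (n + 1 - k div 2))"
      unfolding alternating_power_sum by simp
  next
    show "\<forall>k\<in>{..n} - {k. k \<le> n \<and> 4 dvd int k - 2}.
        2 ^ (n + 1) * (?c k * ?S k) = 0"
      unfolding alternating_power_sum by (auto simp: mod4)
  qed auto
  \<comment> \<open>These are the two pairs at distance 1; they enter \<open>?D\<close> with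
    opposite signs.\<close>
  have y: "x + ?y0 = (x + ?y1) + 1" "x + ?y3 = (x + ?y2) + 1"
    by (simp_all add: complex_eq_iff)
  have "?D = (bernpoly n ((x + ?y1) + 1) - bernpoly n (x + ?y1))
      - (bernpoly n ((x + ?y2) + 1) - bernpoly n (x + ?y2))"
    unfolding y by (simp only: diff_conv_add_uminus minus_add_distrib minus_minus add_ac)
  also have "\<dots> = of_nat n * ((x + ?y1) ^ (n - 1) - (x + ?y2) ^ (n - 1))"
    unfolding bernpoly_diff[OF assms] right_diff_distrib ..
  finally have "?D = of_nat n * ((x + ?y1) ^ (n - 1) - (x + ?y2) ^ (n - 1))" .
  \<comment> \<open>The factor \<open>2 ^ (n - 1)\<close> moves into the powers and clears the
    halves in \<open>?y1\<close> and \<open>?y2\<close>.\<close>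
  moreover have "2 ^ (n + 1) = (4 * 2 ^ (n - 1) :: complex)"
    using assms by (cases n) auto
  ultimately have "4 * \<i> * ?L
      = 4 * of_nat n * ((2 * (x + ?y1)) ^ (n - 1) - (2 * (x + ?y2)) ^ (n - 1))"
    unfolding L[symmetric] power_mult_distrib by (simp only: right_diff_distrib mult_ac)
  moreover have "2 * (x + ?y1) = 2 * x - 1 + \<i>" "2 * (x + ?y2) = 2 * x - 1 - \<i>"
    by (simp_all add: complex_eq_iff)
  ultimately have "4 * \<i> * ?L
      = 4 * of_nat n * ((2 * x - 1 + \<i>) ^ (n - 1) - (2 * x - 1 - \<i>) ^ (n - 1))"
    by (simp only:)
  \<comment> \<open>The sign from \<open>\<i> * \<i> = - 1\<close> exchanges the two powers.\<close>
  also have "\<dots> = 4 * \<i> * ?R"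
    by (simp add: algebra_simps)
  finally show ?thesis
    by simp
qed

end
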